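(* Let $L>0$, let $F:\mathbb{R}^d\to\mathbb{R}^d$ be a $\frac1L$-cocoercive operator, and let $\boldsymbol{u}^*\in\mathbb{R}^d$ satisfy $F(\boldsymbol{u}^* )=\mathbf{0}$. Let $\boldsymbol{u}_0\in\mathbb{R}^d$ be arbitrary and, for $k\ge0$, let $$\boldsymbol{u}_{k+1}=\frac{1}{k+2}\boldsymbol{u}_0+\frac{k+1}{k+2}\Big(\boldsymbol{u}_k-\frac2LF(\boldsymbol{u}_k)\Big).$$ Then, for all $k\ge1$, $$\|F(\boldsymbol{u}_k)\|\le\frac{L\|\boldsymbol{u}_0-\boldsymbol{u}^*\|}{k+1}.$$
   Context: $\|\cdot\| = \sqrt{\langle\cdot,\cdot\rangle}$ is the norm induced by an inner product on $\mathbb{R}^d$. $F$ is $\frac1L$-cocoercive if $\langle F(\boldsymbol{u})-F(\boldsymbol{v}),\boldsymbol{u}-\boldsymbol{v}\rangle\ge\frac1L\|F(\boldsymbol{u})-F(\boldsymbol{v})\|^2$ for all $\boldsymbol{u},\boldsymbol{v}\in\mathbb{R}^d$. *)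

theory Defs
  imports "HOL-Analysis.Analysis"
begin

(* The inner product on R^d is an explicit parameter rather than the type-class
   constant "inner", which on real ^ 'n is only the standard dot product. *)

definition is_inner_product :: "('a::real_vector \<Rightarrow> 'a \<Rightarrow> real) \<Rightarrow> bool" where
  "is_inner_product ip \<longleftrightarrow>
     bilinear ip \<and> (\<forall>x y. ip x y = ip y x) \<and> (\<forall>x. x \<noteq> 0 \<longrightarrow> ip x x > 0)"

definition induced_norm :: "('a \<Rightarrow> 'a \<Rightarrow> real) \<Rightarrow> 'a \<Rightarrow> real" where
  "induced_norm ip x = sqrt (ip x x)"

definition cocoercive :: "('a::real_vector \<Rightarrow> 'a \<Rightarrow> real) \<Rightarrow> real \<Rightarrow> ('a \<Rightarrow> 'a) \<Rightarrow> bool" where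
  "cocoercive ip c F \<longleftrightarrow>
     (\<forall>u v. ip (F u - F v) (u - v) \<ge> c * (induced_norm ip (F u - F v))\<^sup>2)"

end

theory Submission
  imports Defs
begin

text \<open>
  Write \<open>g\<^sub>k = F (u k)\<close>. The recursion is Halpern's iteration, anchored at \<open>u 0\<close>, for the
  nonexpansive map \<open>x - (2 / L) F x\<close>. The whole argument rests on the invariant
  \<open>(k / L) \<parallel>g\<^sub>k\<parallel>\<^sup>2 \<le> \<langle>g\<^sub>k, u 0 - u k\<rangle>\<close>, which is trivial for \<open>k = 0\<close> and is propagated by
  cocoercivity between two consecutive iterates (\<open>halpern_step\<close>): the step size \<open>2 / L\<close> and the
  weight \<open>1 / (k + 2)\<close> are such that all terms in \<open>\<parallel>g\<^sub>k\<parallel>\<^sup>2\<close> cancel against the invariant at \<open>k\<close>.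

  Cocoercivity between \<open>u k\<close> and the zero \<open>u\<^sup>*\<close> gives
  \<open>(1 / L) \<parallel>g\<^sub>k\<parallel>\<^sup>2 \<le> \<langle>g\<^sub>k, u k - u\<^sup>*\<rangle>\<close>. Adding this to the invariant eliminates \<open>u k\<close>:
  \<open>((k + 1) / L) \<parallel>g\<^sub>k\<parallel>\<^sup>2 \<le> \<langle>g\<^sub>k, u 0 - u\<^sup>*\<rangle>\<close>. The Cauchy--Schwarz inequality and division by
  \<open>\<parallel>g\<^sub>k\<parallel>\<close> yield the rate. Spending the last cocoercivity inequality in full, rather than only
  the monotonicity it implies, is what turns \<open>k\<close> into \<open>k + 1\<close>.
\<close>

lemma inner_product_nonneg:
  assumes "is_inner_product ip"
  shows "0 \<le> ip x x"
proof (cases "x = 0")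
  case True
  with assms show ?thesis
    by (simp add: is_inner_product_def bilinear_lzero)
next
  case False
  with assms show ?thesis
    by (simp add: is_inner_product_def less_imp_le)
qed

lemma induced_norm_power2:
  assumes "is_inner_product ip"
  shows "(induced_norm ip x)\<^sup>2 = ip x x"
  using inner_product_nonneg[OF assms] by (simp add: induced_norm_def)

lemma induced_norm_nonneg:
  assumes "is_inner_product ip"
  shows "0 \<le> induced_norm ip x"
  using inner_product_nonneg[OF assms] by (simp add: induced_norm_def)

lemma induced_norm_pos:
  assumes "is_inner_product ip" "x \<noteq> 0"
  shows "0 < induced_norm ip x"
  using assms by (simp add: induced_norm_def is_inner_product_def)

lemma induced_norm_Cauchy_Schwarz:
  assumes ip: "is_inner_product ip"
  shows "ip x y \<le> induced_norm ip x * induced_norm ip y"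
proof (cases "x = 0 \<or> y = 0")
  case True
  with ip have "ip x y = 0"
    by (auto simp: is_inner_product_def bilinear_lzero bilinear_rzero)
  with ip show ?thesis
    by (simp add: induced_norm_nonneg)
next
  case False
  define a b where "a = induced_norm ip x" and "b = induced_norm ip y"
  have bil: "bilinear ip" and sym: "ip y x = ip x y"
    using ip by (auto simp: is_inner_product_def)
  have pos: "0 < a * b"
    using False ip by (simp add: a_def b_def induced_norm_pos)
  have sq: "ip x x = a\<^sup>2" "ip y y = b\<^sup>2"
    by (simp_all add: a_def b_def induced_norm_power2[OF ip])
  have "0 \<le> ip (b *\<^sub>R x - a *\<^sub>R y) (b *\<^sub>R x - a *\<^sub>R y)"
    by (rule inner_product_nonneg[OF ip])
  also have "\<dots> = 2 * (a * b) * (a * b - ip x y)"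
    by (simp add: bilinear_lsub[OF bil] bilinear_rsub[OF bil] bilinear_lmul[OF bil]
        bilinear_rmul[OF bil] sym sq algebra_simps power2_eq_square)
  finally show ?thesis
    using pos by (simp add: zero_le_mult_iff a_def b_def)
qed

lemma cocoerciveD:
  assumes "is_inner_product ip" "cocoercive ip c F"
  shows "c * ip (F x - F y) (F x - F y) \<le> ip (F x - F y) (x - y)"
  using assms by (simp add: cocoercive_def induced_norm_power2)

text \<open>
  The algebra is that of a single step from \<open>x\<close> to \<open>x'\<close> with anchor \<open>a\<close>. Both \<open>x' - x\<close> and
  \<open>a - x'\<close> are combinations of \<open>a - x\<close> and \<open>F x\<close>, so that cocoercivity at the pair \<open>x'\<close>, \<open>x\<close>
  and the desired conclusion become linear inequalities in the same inner products.
\<close>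

lemma halpern_step:
  fixes t c :: real
  assumes ip: "is_inner_product ip" and coco: "cocoercive ip c F" and t: "0 \<le> t"
    and x': "x' = (1 / (t + 2)) *\<^sub>R a + ((t + 1) / (t + 2)) *\<^sub>R (x - (2 * c) *\<^sub>R F x)"
    and inv: "t * c * ip (F x) (F x) \<le> ip (F x) (a - x)"
  shows "(t + 1) * c * ip (F x') (F x') \<le> ip (F x') (a - x')"
proof -
  define g g' w where "g = F x" and "g' = F x'" and "w = a - x"
  have bil: "bilinear ip" and sym: "ip g' g = ip g g'"
    using ip by (auto simp: is_inner_product_def)
  note expand = bilinear_lsub[OF bil] bilinear_rsub[OF bil] bilinear_radd[OF bil]
    bilinear_lmul[OF bil] bilinear_rmul[OF bil]
  have weights: "1 / (t + 2) = 1 - (t + 1) / (t + 2)"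
    using t by (simp add: field_simps)
  have incr: "x' - x = (1 / (t + 2)) *\<^sub>R (w - (2 * c * (t + 1)) *\<^sub>R g)"
  proof -
    have "x = (1 / (t + 2)) *\<^sub>R x + ((t + 1) / (t + 2)) *\<^sub>R x"
      by (simp add: weights flip: scaleR_left_distrib)
    then have "x' - x = (1 / (t + 2)) *\<^sub>R (a - x) - ((t + 1) / (t + 2)) *\<^sub>R (2 * c) *\<^sub>R g"
      unfolding x' g_def by (simp add: scaleR_right_diff_distrib algebra_simps)
    then show ?thesis
      by (simp add: w_def scaleR_right_diff_distrib mult.commute)
  qed
  have anchor: "a - x' = ((t + 1) / (t + 2)) *\<^sub>R (w + (2 * c) *\<^sub>R g)"
    unfolding x' g_def w_def weights by (simp add: algebra_simps)
  have "c * ip (g' - g) (g' - g) \<le> ip (g' - g) (x' - x)"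
    using cocoerciveD[OF ip coco] by (simp add: g_def g'_def)
  also have "\<dots> = (ip (g' - g) (w - (2 * c * (t + 1)) *\<^sub>R g)) / (t + 2)"
    unfolding incr by (simp add: bilinear_rmul[OF bil])
  finally have "(t + 2) * (c * ip (g' - g) (g' - g)) \<le> ip (g' - g) (w - (2 * c * (t + 1)) *\<^sub>R g)"
    using t by (simp add: field_simps)
  then have "(t + 2) * c * ip g' g' \<le> ip g' w + 2 * c * ip g g'"
    using inv unfolding g_def[symmetric] w_def[symmetric]
    by (simp add: expand sym algebra_simps)
  then have "(t + 1) / (t + 2) * ((t + 2) * c * ip g' g')
      \<le> (t + 1) / (t + 2) * (ip g' w + 2 * c * ip g g')"
    using t by (intro mult_left_mono) auto
  also have "\<dots> = ip g' (a - x')"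
    unfolding anchor by (simp add: expand sym)
  finally show ?thesis
    using t by (simp add: g'_def)
qed

lemma halpern_invariant:
  fixes u :: "nat \<Rightarrow> 'a::real_vector"
  assumes ip: "is_inner_product ip" and coco: "cocoercive ip c F"
    and rec: "\<And>k. u (Suc k) = (1 / (real k + 2)) *\<^sub>R u 0
           + ((real k + 1) / (real k + 2)) *\<^sub>R (u k - (2 * c) *\<^sub>R F (u k))"
  shows "real k * c * ip (F (u k)) (F (u k)) \<le> ip (F (u k)) (u 0 - u k)"
proof (induction k)
  case 0
  from ip show ?case
    by (simp add: is_inner_product_def bilinear_lzero bilinear_rzero)
next
  case (Suc k)
  from halpern_step[OF ip coco _ rec Suc.IH] show ?case
    by (simp add: add.commute)
qed

theorem lemma3p2:
  fixes ip :: "real ^ 'n \<Rightarrow> real ^ 'n \<Rightarrow> real"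
    and F :: "real ^ 'n \<Rightarrow> real ^ 'n"
    and L :: real
    and ustar :: "real ^ 'n"
    and u :: "nat \<Rightarrow> real ^ 'n"
  assumes "is_inner_product ip"
    and "L > 0"
    and "cocoercive ip (1 / L) F"
    and "F ustar = 0"
    and "\<And>k. u (Suc k) =
           (1 / (real k + 2)) *\<^sub>R u 0
           + ((real k + 1) / (real k + 2)) *\<^sub>R (u k - (2 / L) *\<^sub>R F (u k))"
  shows "\<forall>k\<ge>1. induced_norm ip (F (u k)) \<le> L * induced_norm ip (u 0 - ustar) / (real k + 1)"
proof (intro allI impI)
  fix k :: nat
  define g where "g = F (u k)"
  define N where "N = induced_norm ip g"
  define D where "D = induced_norm ip (u 0 - ustar)"
  have bil: "bilinear ip"
    using assms(1) by (simp add: is_inner_product_def)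
  have "real k * (1 / L) * ip g g \<le> ip g (u 0 - u k)"
    unfolding g_def by (rule halpern_invariant[OF assms(1,3)]) (simp add: assms(5))
  moreover have "(1 / L) * ip g g \<le> ip g (u k - ustar)"
    using cocoerciveD[OF assms(1,3), of "u k" ustar] by (simp add: g_def assms(4))
  moreover have "ip g (u 0 - ustar) = ip g (u 0 - u k) + ip g (u k - ustar)"
    by (simp flip: bilinear_radd[OF bil])
  ultimately have "(real k + 1) * (1 / L) * ip g g \<le> ip g (u 0 - ustar)"
    by (simp add: distrib_right add_divide_distrib)
  also have "\<dots> \<le> N * D"
    unfolding N_def D_def by (rule induced_norm_Cauchy_Schwarz[OF assms(1)])
  finally have "N * ((real k + 1) * N) \<le> N * (L * D)"
    using \<open>L > 0\<close> by (simp add: N_def power2_eq_square field_simps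
        flip: induced_norm_power2[OF assms(1)])
  moreover have "0 \<le> N" "0 \<le> D"
    by (simp_all add: N_def D_def induced_norm_nonneg[OF assms(1)])
  ultimately have "(real k + 1) * N \<le> L * D"
    using \<open>L > 0\<close> by (cases "N = 0") (auto simp: mult_le_cancel_left)
  then show "induced_norm ip (F (u k)) \<le> L * induced_norm ip (u 0 - ustar) / (real k + 1)"
    by (simp add: N_def D_def g_def field_simps)
qed

end
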